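(* Let $V=\{1,\dots,n\}$, $m\ge1$, and let $f_1,\dots,f_m:2^V\to\mathbb{R}$ be normalized, monotone non-decreasing, submodular functions. Let $\epsilon>0$, $0\le\alpha\le1$, $0\le\lambda\le1$, $\bar\lambda=1-\lambda$, and let $\hat\pi$ be the output of GeneralGreedSat (described in the context). Let $OPT=\max_{\pi\in\Pi}\big[\bar\lambda\min_i f_i(A_i^\pi)+\frac{\lambda}{m}\sum_{i=1}^m f_i(A_i^\pi)\big]$. Then $$\bar\lambda\min_i f_i(A_i^{\hat\pi})+\frac{\lambda}{m}\sum_{i=1}^m f_i(A_i^{\hat\pi})\ \ge\ \lambda\alpha\,(OPT-\epsilon).$$ Moreover, letting $F_{\lambda,i}(\pi)=\bar\lambda f_i(A_i^\pi)+\frac{\lambda}{m}\sum_{j=1}^m f_j(A_j^\pi)$, for any $0<\delta<\alpha$ there is a set $I\subseteq\{1,\dots,m\}$ with $|I|\ge\lceil m(\alpha-\delta)\rceil$ such that $$F_{\lambda,i}(\hat\pi)\ \ge\ \max\Big\{\frac{\delta}{1-\alpha+\delta},\lambda\alpha\Big\}(OPT-\epsilon)\quad\text{for all } i\in I.$$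
   Context: $f$ is normalized if $f(\emptyset)=0$, monotone non-decreasing if $f(S)\le f(T)$ for $S\subseteq T$, submodular if $f(S)+f(T)\ge f(S\cup T)+f(S\cap T)$. $\Pi$ is the set of ordered partitions of $V$ into $m$ pairwise disjoint (possibly empty) blocks covering $V$. For $c\ge0$ define $\bar F^c_\lambda(\pi)=\frac1m\sum_{i=1}^m\min\{\bar\lambda f_i(A_i^\pi)+\frac{\lambda}{m}\sum_{j=1}^m f_j(A_j^\pi),\,c\}$. A subroutine, given $c$, returns $\hat\pi^c$ with $\bar F^c_\lambda(\hat\pi^c)\ge\alpha\max_{\pi\in\Pi}\bar F^c_\lambda(\pi)$. GeneralGreedSat: set $c_{\min}=0$, $c_{\max}=\sum_{i=1}^m f_i(V)$; while $c_{\max}-c_{\min}\ge\epsilon$: $c=\frac12(c_{\max}+c_{\min})$, compute $\hat\pi^c$ by the subroutine; if $\bar F^c_\lambda(\hat\pi^c)<\alpha c$ set $c_{\max}=c$, else set $c_{\min}=c$ and $\hat\pi\leftarrow\hat\pi^c$. Output $\hat\pi$. *)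

theory Defs
  imports Complex_Main "HOL-Library.FuncSet" "HOL-Library.Disjoint_Sets"
    "HOL-Library.While_Combinator"
begin

definition normalized :: "('a set \<Rightarrow> real) \<Rightarrow> bool" where
  "normalized f \<longleftrightarrow> f {} = 0"

definition submodular_on :: "'a set \<Rightarrow> ('a set \<Rightarrow> real) \<Rightarrow> bool" where
  "submodular_on V f \<longleftrightarrow>
     (\<forall>S T. S \<subseteq> V \<and> T \<subseteq> V \<longrightarrow> f S + f T \<ge> f (S \<union> T) + f (S \<inter> T))"

text \<open>The blocks are indexed by \<open>{1..m}\<close>; taking extensional functions makes each ordered
  partition have exactly one representation, so that the set is finite when \<open>V\<close> is.\<close>

definition ordered_partitions :: "'a set \<Rightarrow> nat \<Rightarrow> (nat \<Rightarrow> 'a set) set" where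
  "ordered_partitions V m =
     {A \<in> {1..m} \<rightarrow>\<^sub>E Pow V. disjoint_family_on A {1..m} \<and> (\<Union>i\<in>{1..m}. A i) = V}"

definition F_mix ::
    "real \<Rightarrow> nat \<Rightarrow> (nat \<Rightarrow> 'a set \<Rightarrow> real) \<Rightarrow> nat \<Rightarrow> (nat \<Rightarrow> 'a set) \<Rightarrow> real" where
  "F_mix lam m f i A = (1 - lam) * f i (A i) + lam / real m * (\<Sum>j=1..m. f j (A j))"

definition F_trunc ::
    "real \<Rightarrow> nat \<Rightarrow> (nat \<Rightarrow> 'a set \<Rightarrow> real) \<Rightarrow> real \<Rightarrow> (nat \<Rightarrow> 'a set) \<Rightarrow> real" where
  "F_trunc lam m f c A = 1 / real m * (\<Sum>i=1..m. min (F_mix lam m f i A) c)"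

definition objective ::
    "real \<Rightarrow> nat \<Rightarrow> (nat \<Rightarrow> 'a set \<Rightarrow> real) \<Rightarrow> (nat \<Rightarrow> 'a set) \<Rightarrow> real" where
  "objective lam m f A =
     (1 - lam) * Min ((\<lambda>i. f i (A i)) ` {1..m}) + lam / real m * (\<Sum>i=1..m. f i (A i))"

definition OPT :: "real \<Rightarrow> 'a set \<Rightarrow> nat \<Rightarrow> (nat \<Rightarrow> 'a set \<Rightarrow> real) \<Rightarrow> real" where
  "OPT lam V m f = Max (objective lam m f ` ordered_partitions V m)"

definition approx_subroutine ::
    "real \<Rightarrow> real \<Rightarrow> 'a set \<Rightarrow> nat \<Rightarrow> (nat \<Rightarrow> 'a set \<Rightarrow> real) \<Rightarrow> (real \<Rightarrow> nat \<Rightarrow> 'a set) \<Rightarrow> bool" where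
  "approx_subroutine \<alpha> lam V m f sub \<longleftrightarrow>
     (\<forall>c\<ge>0. sub c \<in> ordered_partitions V m \<and>
        F_trunc lam m f c (sub c) \<ge> \<alpha> * Max (F_trunc lam m f c ` ordered_partitions V m))"

text \<open>The state is \<open>(c_min, c_max, current partition)\<close>. The argument \<open>\<pi>0\<close> is the content of the
  partition variable before the loop; it is returned if no iteration assigns the variable.\<close>

definition GeneralGreedSat ::
    "real \<Rightarrow> real \<Rightarrow> real \<Rightarrow> 'a set \<Rightarrow> nat \<Rightarrow> (nat \<Rightarrow> 'a set \<Rightarrow> real) \<Rightarrow> (real \<Rightarrow> nat \<Rightarrow> 'a set)
      \<Rightarrow> (nat \<Rightarrow> 'a set) \<Rightarrow> (nat \<Rightarrow> 'a set)" where
  "GeneralGreedSat \<epsilon> \<alpha> lam V m f sub \<pi>0 =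
     snd (snd (while
       (\<lambda>(cmin, cmax, \<pi>). cmax - cmin \<ge> \<epsilon>)
       (\<lambda>(cmin, cmax, \<pi>).
          let c = (cmax + cmin) / 2; \<pi>c = sub c
          in if F_trunc lam m f c \<pi>c < \<alpha> * c then (cmin, c, \<pi>) else (c, cmax, \<pi>c))
       (0, (\<Sum>i=1..m. f i V), \<pi>0)))"

end

theory Submission imports Defs begin

text \<open>
  Every value \<open>c \<le> OPT\<close> is attained as the maximum of the truncated objective at level \<open>c\<close>, so a
  failed test at level \<open>c\<close> certifies \<open>OPT < c\<close>. Hence the bisection keeps \<open>OPT \<le> c\<^sub>m\<^sub>a\<^sub>x\<close> and
  truncated value at least \<open>\<alpha> c\<^sub>m\<^sub>i\<^sub>n\<close> for the current partition, and it ends with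
  \<open>c\<^sub>m\<^sub>i\<^sub>n > OPT - \<epsilon>\<close>. For the first bound, the truncated value is at most the average of the
  \<open>f\<^sub>i(A\<^sub>i)\<close>. For the second, a Markov-type count: if only \<open>k\<close> indices reach \<open>\<beta> c\<close> with
  \<open>\<beta> = \<delta> / (1 - \<alpha> + \<delta>)\<close>, then \<open>m \<alpha> c \<le> k c + (m - k) \<beta> c\<close>, and this \<open>\<beta>\<close> is the one that turns the
  inequality into \<open>k \<ge> m (\<alpha> - \<delta>)\<close>.
\<close>

section \<open>Ordered partitions and nonnegative block values\<close>

lemma finite_ordered_partitions:
  assumes "finite V"
  shows "finite (ordered_partitions V m)"
proof -
  have "finite ({1..m} \<rightarrow>\<^sub>E Pow V)" using assms by (intro finite_PiE) auto
  then show ?thesis unfolding ordered_partitions_def by (rule rev_finite_subset) auto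
qed

lemma ordered_partitions_block_subset:
  assumes "A \<in> ordered_partitions V m" and "i \<in> {1..m}"
  shows "A i \<subseteq> V"
  using assms by (auto simp: ordered_partitions_def)

lemma normalized_mono_on_nonneg:
  assumes "normalized f" and "mono_on (Pow V) f" and "S \<subseteq> V"
  shows "0 \<le> f S"
  using mono_onD[OF assms(2), of "{}" S] assms by (simp add: normalized_def)

lemma block_value_nonneg:
  assumes "A \<in> ordered_partitions V m" and "i \<in> {1..m}"
    and "\<And>i. i \<in> {1..m} \<Longrightarrow> normalized (f i)"
    and "\<And>i. i \<in> {1..m} \<Longrightarrow> mono_on (Pow V) (f i)"
  shows "0 \<le> f i (A i)"
  by (rule normalized_mono_on_nonneg[OF assms(3,4) ordered_partitions_block_subset]) fact+

section \<open>Comparing the objective, \<open>F_mix\<close> and \<open>F_trunc\<close>\<close>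

lemma objective_le_F_mix:
  assumes "lam \<le> 1" and "i \<in> {1..m}"
  shows "objective lam m f A \<le> F_mix lam m f i A"
proof -
  have "Min ((\<lambda>i. f i (A i)) ` {1..m}) \<le> f i (A i)"
    using assms by (intro Min_le) auto
  then show ?thesis
    using assms by (simp add: objective_def F_mix_def mult_left_mono)
qed

lemma F_mix_nonneg:
  assumes "0 \<le> lam" and "lam \<le> 1" and "\<And>j. j \<in> {1..m} \<Longrightarrow> 0 \<le> f j (A j)" and "i \<in> {1..m}"
  shows "0 \<le> F_mix lam m f i A"
  unfolding F_mix_def using assms
  by (intro add_nonneg_nonneg mult_nonneg_nonneg sum_nonneg divide_nonneg_nonneg) auto

text \<open>The coupling term is the same for every index; its m copies supply exactly the share
  \<open>lam\<close> of the sum that the factor \<open>1 - lam\<close> removes. Hence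
  \<open>F_trunc\<close> can be compared with the plain average of the block values.\<close>

lemma sum_F_mix:
  assumes "m \<ge> 1"
  shows "(\<Sum>i=1..m. F_mix lam m f i A) = (\<Sum>i=1..m. f i (A i))"
proof -
  let ?s = "\<Sum>i=1..m. f i (A i)"
  have "(\<Sum>i=1..m. F_mix lam m f i A) = (1 - lam) * ?s + real m * (lam / real m * ?s)"
    by (simp add: F_mix_def sum.distrib sum_distrib_left)
  also have "\<dots> = ?s" using assms by (simp add: field_simps)
  finally show ?thesis .
qed

lemma F_trunc_le_average:
  assumes "m \<ge> 1"
  shows "F_trunc lam m f c A \<le> 1 / real m * (\<Sum>i=1..m. f i (A i))"
proof -
  have "(\<Sum>i=1..m. min (F_mix lam m f i A) c) \<le> (\<Sum>i=1..m. F_mix lam m f i A)"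
    by (intro sum_mono) auto
  then show ?thesis
    unfolding F_trunc_def sum_F_mix[OF assms] by (intro mult_left_mono) auto
qed

text \<open>A level below the objective lies below every \<open>F_mix\<close> value, so truncation
  cuts each summand down to \<open>c\<close>.\<close>

lemma F_trunc_eq_level:
  assumes "m \<ge> 1" and "lam \<le> 1" and "c \<le> objective lam m f A"
  shows "F_trunc lam m f c A = c"
proof -
  have "min (F_mix lam m f i A) c = c" if "i \<in> {1..m}" for i
    using objective_le_F_mix[OF assms(2) that, of f A] assms(3) by simp
  then have "(\<Sum>i=1..m. min (F_mix lam m f i A) c) = (\<Sum>i=1..m. c)"
    by (intro sum.cong) auto
  then show ?thesis using assms(1) by (simp add: F_trunc_def)
qed

text \<open>Control of the average says nothing about the smallest block value beyond its being
  nonnegative, so only the share \<open>lam\<close> of the average survives. This is the source of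
  the factor \<open>lam\<close> in the first guarantee.\<close>

lemma objective_ge_average:
  assumes "m \<ge> 1" and "lam \<le> 1" and "\<And>j. j \<in> {1..m} \<Longrightarrow> 0 \<le> f j (A j)"
  shows "lam * (1 / real m * (\<Sum>i=1..m. f i (A i))) \<le> objective lam m f A"
proof -
  have "0 \<le> Min ((\<lambda>i. f i (A i)) ` {1..m})"
    using assms(1,3) by (subst Min_ge_iff) auto
  then show ?thesis using assms(2) by (simp add: objective_def)
qed

lemma objective_le_sum:
  assumes "m \<ge> 1" and "0 \<le> lam" and "lam \<le> 1" and "\<And>j. j \<in> {1..m} \<Longrightarrow> 0 \<le> f j (A j)"
  shows "objective lam m f A \<le> (\<Sum>i=1..m. f i (A i))"
proof -
  let ?s = "\<Sum>i=1..m. f i (A i)"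
  have s: "0 \<le> ?s" using assms(4) by (intro sum_nonneg) auto
  have one: "1 \<in> {1..m}" using assms(1) by auto
  \<comment> \<open>Any single index would do: its \<open>F_mix\<close> bounds the objective and is
    a convex combination of a block value and the average, both at most the sum.\<close>
  have "f 1 (A 1) \<le> ?s"
    using assms(4) by (intro member_le_sum[OF one]) auto
  then have "(1 - lam) * f 1 (A 1) \<le> (1 - lam) * ?s"
    using assms(3) by (intro mult_left_mono) auto
  moreover have "lam / real m * ?s \<le> lam * ?s"
  proof -
    have "lam / real m \<le> lam" using assms(1,2) by (simp add: field_simps mult_le_cancel_left1)
    then show ?thesis using s by (intro mult_right_mono) auto
  qed
  ultimately have "F_mix lam m f 1 A \<le> (1 - lam) * ?s + lam * ?s"
    by (simp add: F_mix_def)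
  with objective_le_F_mix[OF assms(3) one, of f A] show ?thesis by (simp add: algebra_simps)
qed

section \<open>Upper bounds on the optimum\<close>

text \<open>Makes the initial \<open>cmax\<close> of the bisection a valid upper bound; monotonicity
  passes from the blocks to \<open>V\<close>.\<close>

lemma OPT_le_sum:
  assumes "finite V" and "ordered_partitions V m \<noteq> {}" and "m \<ge> 1" and "0 \<le> lam" and "lam \<le> 1"
    and "\<And>i. i \<in> {1..m} \<Longrightarrow> normalized (f i)"
    and "\<And>i. i \<in> {1..m} \<Longrightarrow> mono_on (Pow V) (f i)"
  shows "OPT lam V m f \<le> (\<Sum>i=1..m. f i V)"
  unfolding OPT_def
proof (subst Max_le_iff)
  show "\<forall>a\<in>objective lam m f ` ordered_partitions V m. a \<le> (\<Sum>i=1..m. f i V)"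
  proof (clarify)
    fix A assume A: "A \<in> ordered_partitions V m"
    have "0 \<le> f i (A i)" if "i \<in> {1..m}" for i
      using block_value_nonneg[OF A that assms(6,7)] .
    then have "objective lam m f A \<le> (\<Sum>i=1..m. f i (A i))"
      by (intro objective_le_sum assms(3-5))
    also have "\<dots> \<le> (\<Sum>i=1..m. f i V)"
    proof (rule sum_mono)
      fix i assume "i \<in> {1..m}"
      then show "f i (A i) \<le> f i V"
        using mono_onD[OF assms(7), of i "A i" V] ordered_partitions_block_subset[OF A, of i] by blast
    qed
    finally show "objective lam m f A \<le> (\<Sum>i=1..m. f i V)" .
  qed
qed (use assms(1,2) in \<open>simp_all add: finite_ordered_partitions\<close>)

lemma OPT_less_if_test_fails:
  assumes "finite V" and "ordered_partitions V m \<noteq> {}" and "m \<ge> 1" and "lam \<le> 1" and "0 \<le> \<alpha>"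
    and sub: "approx_subroutine \<alpha> lam V m f sub" and "0 \<le> c"
    and fail: "F_trunc lam m f c (sub c) < \<alpha> * c"
  shows "OPT lam V m f < c"
proof (rule ccontr)
  assume "\<not> OPT lam V m f < c"
  have fin: "finite (ordered_partitions V m)" by (rule finite_ordered_partitions) fact
  then have "OPT lam V m f \<in> objective lam m f ` ordered_partitions V m"
    unfolding OPT_def using assms(2) by (intro Max_in) auto
  then obtain A where A: "A \<in> ordered_partitions V m" "OPT lam V m f = objective lam m f A"
    by auto
  then have "F_trunc lam m f c A = c"
    using \<open>\<not> OPT lam V m f < c\<close> assms by (intro F_trunc_eq_level) auto
  then have "c \<le> Max (F_trunc lam m f c ` ordered_partitions V m)"
    using A(1) fin by (intro Max_ge) force+
  then have "\<alpha> * c \<le> \<alpha> * Max (F_trunc lam m f c ` ordered_partitions V m)"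
    using \<open>0 \<le> \<alpha>\<close> by (rule mult_left_mono)
  also have "\<dots> \<le> F_trunc lam m f c (sub c)"
    using sub \<open>0 \<le> c\<close> by (simp add: approx_subroutine_def)
  finally show False using fail by simp
qed

section \<open>The bisection loop\<close>

text \<open>Supplies the termination measure: each pass halves the interval length in units of
  \<epsilon>, and the loop condition says that this number is at least 1.\<close>

lemma floor_half_less:
  fixes x :: real
  assumes "1 \<le> x"
  shows "nat \<lfloor>x / 2\<rfloor> < nat \<lfloor>x\<rfloor>"
proof -
  have "1 \<le> \<lfloor>x\<rfloor>" using assms by simp
  moreover from this have "x / 2 < of_int \<lfloor>x\<rfloor>" by linarith
  then have "\<lfloor>x / 2\<rfloor> < \<lfloor>x\<rfloor>" by (simp add: floor_less_iff)
  ultimately show ?thesis by linarith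
qed

lemma GeneralGreedSat_certificate:
  assumes "finite V" and "m \<ge> 1"
    and norm: "\<And>i. i \<in> {1..m} \<Longrightarrow> normalized (f i)"
    and mono: "\<And>i. i \<in> {1..m} \<Longrightarrow> mono_on (Pow V) (f i)"
    and "\<epsilon> > 0" and "0 \<le> \<alpha>" and "0 \<le> lam" and "lam \<le> 1"
    and sub: "approx_subroutine \<alpha> lam V m f sub"
    and "\<pi>0 \<in> ordered_partitions V m"
  obtains c where "0 \<le> c" and "OPT lam V m f - \<epsilon> \<le> c"
    and "GeneralGreedSat \<epsilon> \<alpha> lam V m f sub \<pi>0 \<in> ordered_partitions V m"
    and "\<alpha> * c \<le> F_trunc lam m f c (GeneralGreedSat \<epsilon> \<alpha> lam V m f sub \<pi>0)"
proof -
  \<comment> \<open>Only \<open>cmax\<close> is compared with \<open>OPT\<close>: an accepted level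
    may exceed \<open>OPT\<close> when \<alpha> < 1, so \<open>cmin \<le> OPT\<close> is not
    claimed.\<close>
  define inv where "inv = (\<lambda>(cmin, cmax, \<pi>). 0 \<le> cmin \<and> cmin \<le> cmax \<and> OPT lam V m f \<le> cmax \<and>
    \<pi> \<in> ordered_partitions V m \<and> \<alpha> * cmin \<le> F_trunc lam m f cmin \<pi>)"
  let ?b = "\<lambda>(cmin, cmax, \<pi>). cmax - cmin \<ge> \<epsilon>"
  let ?c = "\<lambda>(cmin, cmax, \<pi>).
          let c = (cmax + cmin) / 2; \<pi>c = sub c
          in if F_trunc lam m f c \<pi>c < \<alpha> * c then (cmin, c, \<pi>) else (c, cmax, \<pi>c)"
  let ?r = "measure (\<lambda>(cmin, cmax, \<pi> :: nat \<Rightarrow> 'a set). nat \<lfloor>(cmax - cmin) / \<epsilon>\<rfloor>)"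
  let ?s = "while ?b ?c (0, (\<Sum>i=1..m. f i V), \<pi>0)"
  have ne: "ordered_partitions V m \<noteq> {}" using assms by auto
  have "inv ?s \<and> \<not> ?b ?s"
  proof (rule while_rule[where P = inv and r = ?r])
    \<comment> \<open>At level 0 the certificate only asks for a nonnegative truncated value, which
      any ordered partition has. This covers runs that return \<open>\<pi>0\<close> itself.\<close>
    have "0 \<le> f i (\<pi>0 i)" if "i \<in> {1..m}" for i
      using block_value_nonneg[OF \<open>\<pi>0 \<in> _\<close> that norm mono] .
    then have "0 \<le> F_mix lam m f i \<pi>0" if "i \<in> {1..m}" for i
      using that by (intro F_mix_nonneg assms(7,8))
    then have "0 \<le> F_trunc lam m f 0 \<pi>0"
      by (auto simp: F_trunc_def intro!: divide_nonneg_nonneg sum_nonneg)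
    moreover have "0 \<le> (\<Sum>i=1..m. f i V)"
      using norm mono by (intro sum_nonneg normalized_mono_on_nonneg) auto
    moreover have "OPT lam V m f \<le> (\<Sum>i=1..m. f i V)"
      by (rule OPT_le_sum) fact+
    ultimately show "inv (0, (\<Sum>i=1..m. f i V), \<pi>0)"
      using assms by (simp add: inv_def)
  next
    fix s assume "inv s" "?b s"
    obtain cmin cmax \<pi> where s: "s = (cmin, cmax, \<pi>)" by (cases s) auto
    define c where "c = (cmax + cmin) / 2"
    have i: "0 \<le> cmin" "cmin \<le> cmax" "OPT lam V m f \<le> cmax"
      "\<pi> \<in> ordered_partitions V m" "\<alpha> * cmin \<le> F_trunc lam m f cmin \<pi>"
      using \<open>inv s\<close> by (auto simp: inv_def s)
    have c: "0 \<le> c" "cmin \<le> c" "c \<le> cmax" using i by (auto simp: c_def)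
    have step: "?c s = (if F_trunc lam m f c (sub c) < \<alpha> * c then (cmin, c, \<pi>) else (c, cmax, sub c))"
      by (simp add: s c_def Let_def)
    show "inv (?c s)"
    proof (cases "F_trunc lam m f c (sub c) < \<alpha> * c")
      case True
      then have "OPT lam V m f < c"
        using c(1) by (intro OPT_less_if_test_fails[OF assms(1) ne assms(2,8,6) sub])
      then show ?thesis unfolding step using True i c by (simp add: inv_def)
    next
      \<comment> \<open>The negated test is literally the certificate for the new
        \<open>cmin\<close>.\<close>
      case False
      moreover have "sub c \<in> ordered_partitions V m"
        using sub c by (simp add: approx_subroutine_def)
      ultimately show ?thesis unfolding step using i c by (simp add: inv_def)
    qed
    have "1 \<le> (cmax - cmin) / \<epsilon>" using \<open>?b s\<close> \<open>\<epsilon> > 0\<close> by (simp add: s)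
    note less = floor_half_less[OF this]
    have "(c - cmin) / \<epsilon> = (cmax - cmin) / \<epsilon> / 2" "(cmax - c) / \<epsilon> = (cmax - cmin) / \<epsilon> / 2"
      using \<open>\<epsilon> > 0\<close> by (simp_all add: c_def field_simps)
    then show "(?c s, s) \<in> ?r"
      unfolding step using less by (simp add: s)
  qed auto
  moreover obtain cmin cmax \<pi> where s: "?s = (cmin, cmax, \<pi>)" by (cases ?s) auto
  moreover have "GeneralGreedSat \<epsilon> \<alpha> lam V m f sub \<pi>0 = \<pi>"
    unfolding GeneralGreedSat_def s by simp
  \<comment> \<open>The witness is the final \<open>cmin\<close>: on exit it is within \<epsilon> of
    \<open>cmax\<close>, which is still at least \<open>OPT\<close>.\<close>
  ultimately show thesis by (intro that[of cmin]) (auto simp: inv_def)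
qed

section \<open>Counting the indices with large value\<close>

lemma truncated_average_many_large:
  fixes g :: "nat \<Rightarrow> real" and \<alpha> \<delta> c :: real
  assumes "m \<ge> 1" and "\<alpha> \<le> 1" and "0 < \<delta>" and "0 \<le> c"
    and g: "\<And>i. i \<in> {1..m} \<Longrightarrow> 0 \<le> g i"
    and avg: "\<alpha> * c \<le> 1 / real m * (\<Sum>i=1..m. min (g i) c)"
  shows "real m * (\<alpha> - \<delta>) \<le> real (card {i \<in> {1..m}. \<delta> / (1 - \<alpha> + \<delta>) * c \<le> g i})"
proof -
  define \<beta> where "\<beta> = \<delta> / (1 - \<alpha> + \<delta>)"
  define I where "I = {i \<in> {1..m}. \<beta> * c \<le> g i}"
  define k where "k = card I"
  have I: "I \<subseteq> {1..m}" "finite I" by (auto simp: I_def)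
  have km: "k \<le> m" using card_mono[OF _ I(1)] by (simp add: k_def)
  have "real m * (\<alpha> - \<delta>) \<le> real k"
  proof (cases "I = {1..m}")
    case True
    then have "k = m" by (simp add: k_def)
    moreover have "real m * (\<alpha> - \<delta>) \<le> real m * 1" using assms by (intro mult_left_mono) auto
    ultimately show ?thesis by simp
  next
    case False
    then obtain j where j: "j \<in> {1..m} - I" using I by blast
    \<comment> \<open>At level 0 the threshold is 0, which every \<open>g i\<close> reaches, so
      \<open>j\<close> could not be missing from \<open>I\<close>.\<close>
    have "c > 0"
    proof (rule ccontr)
      assume "\<not> c > 0"
      then have "c = 0" using assms by simp
      then show False using j g by (auto simp: I_def)
    qed
    have "(\<Sum>i\<in>I. min (g i) c) \<le> (\<Sum>i\<in>I. c)" by (intro sum_mono) auto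
    \<comment> \<open>Strictness comes from the index \<open>j\<close> outside \<open>I\<close> and
      is kept to the end.\<close>
    moreover have "(\<Sum>i\<in>{1..m} - I. min (g i) c) < (\<Sum>i\<in>{1..m} - I. \<beta> * c)"
      using j by (intro sum_strict_mono) (auto simp: I_def min_less_iff_disj)
    moreover have "(\<Sum>i=1..m. min (g i) c) = (\<Sum>i\<in>{1..m} - I. min (g i) c) + (\<Sum>i\<in>I. min (g i) c)"
      using I by (intro sum.subset_diff) auto
    moreover have "card ({1..m} - I) = m - k"
      using I by (simp add: card_Diff_subset k_def)
    moreover have "real m * (\<alpha> * c) \<le> (\<Sum>i=1..m. min (g i) c)"
      using avg \<open>m \<ge> 1\<close> by (simp add: field_simps)
    ultimately have "real m * (\<alpha> * c) < real k * c + real (m - k) * (\<beta> * c)"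
      by (simp add: k_def)
    then have "(real m * \<alpha>) * c < (real k + (real m - real k) * \<beta>) * c"
      using km by (simp add: of_nat_diff algebra_simps)
    then have "real m * \<alpha> < real k + (real m - real k) * \<beta>"
      using \<open>c > 0\<close> by simp
    moreover have d: "0 < 1 - \<alpha> + \<delta>" using assms by simp
    ultimately have "real m * \<alpha> * (1 - \<alpha> + \<delta>) < (real k + (real m - real k) * \<beta>) * (1 - \<alpha> + \<delta>)"
      by (intro mult_strict_right_mono)
    moreover have "\<beta> * (1 - \<alpha> + \<delta>) = \<delta>" using d by (simp add: \<beta>_def)
    then have "(real k + (real m - real k) * \<beta>) * (1 - \<alpha> + \<delta>)
      = real k * (1 - \<alpha> + \<delta>) + (real m - real k) * \<delta>"
      by (simp add: distrib_right mult.assoc)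
    \<comment> \<open>With this \<beta> the terms in \<delta> times k cancel and the rest has the
      common factor 1 - \<alpha>. The strict inequality rules out \<alpha> = 1, so the factor can be
      divided out.\<close>
    ultimately have "(1 - \<alpha>) * (real m * (\<alpha> - \<delta>)) < (1 - \<alpha>) * real k"
      by (simp add: algebra_simps)
    then show ?thesis using assms(2) by (simp add: mult_less_cancel_left)
  qed
  then show ?thesis by (simp add: k_def I_def \<beta>_def)
qed

section \<open>Both guarantees from the certificate\<close>

theorem theorem11:
  fixes n m :: nat and f :: "nat \<Rightarrow> nat set \<Rightarrow> real" and \<epsilon> \<alpha> lam :: real
    and V :: "nat set" and sub :: "real \<Rightarrow> nat \<Rightarrow> nat set" and \<pi>0 \<pi>hat :: "nat \<Rightarrow> nat set"
  assumes "V = {1..n}" and "m \<ge> 1"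
    and "\<And>i. i \<in> {1..m} \<Longrightarrow> normalized (f i)"
    and "\<And>i. i \<in> {1..m} \<Longrightarrow> mono_on (Pow V) (f i)"
    and "\<And>i. i \<in> {1..m} \<Longrightarrow> submodular_on V (f i)"
    and "\<epsilon> > 0" and "0 \<le> \<alpha>" and "\<alpha> \<le> 1" and "0 \<le> lam" and "lam \<le> 1"
    and "approx_subroutine \<alpha> lam V m f sub"
    and "\<pi>0 \<in> ordered_partitions V m"
    and "\<pi>hat = GeneralGreedSat \<epsilon> \<alpha> lam V m f sub \<pi>0"
  shows "objective lam m f \<pi>hat \<ge> lam * \<alpha> * (OPT lam V m f - \<epsilon>) \<and>
    (\<forall>\<delta>. 0 < \<delta> \<and> \<delta> < \<alpha> \<longrightarrow>
       (\<exists>I \<subseteq> {1..m}. int (card I) \<ge> \<lceil>real m * (\<alpha> - \<delta>)\<rceil> \<and>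
          (\<forall>i\<in>I. F_mix lam m f i \<pi>hat
             \<ge> max (\<delta> / (1 - \<alpha> + \<delta>)) (lam * \<alpha>) * (OPT lam V m f - \<epsilon>))))"
proof -
  have fin: "finite V" using assms(1) by simp
  obtain c where c: "0 \<le> c" "OPT lam V m f - \<epsilon> \<le> c" "\<pi>hat \<in> ordered_partitions V m"
    "\<alpha> * c \<le> F_trunc lam m f c \<pi>hat"
    using GeneralGreedSat_certificate[OF fin assms(2,3,4,6,7,9,10,11,12)]
    unfolding assms(13) by blast
  have nonneg: "0 \<le> f i (\<pi>hat i)" if "i \<in> {1..m}" for i
    using block_value_nonneg[OF c(3) that assms(3,4)] .
  have "lam * (\<alpha> * c) \<le> lam * (1 / real m * (\<Sum>i=1..m. f i (\<pi>hat i)))"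
    using c(4) F_trunc_le_average[OF assms(2), of lam f c \<pi>hat] assms(9)
    by (intro mult_left_mono) auto
  also have "\<dots> \<le> objective lam m f \<pi>hat"
    using assms(2,10) nonneg by (intro objective_ge_average) auto
  finally have obj: "lam * \<alpha> * c \<le> objective lam m f \<pi>hat" by (simp add: mult.assoc)
  show ?thesis
  proof (intro conjI allI impI)
    \<comment> \<open>Bounds are proved at level \<open>c\<close> and then weakened; as the factor
      is nonnegative, the sign of \<open>OPT lam V m f - \<epsilon>\<close> does not matter.\<close>
    have "lam * \<alpha> * (OPT lam V m f - \<epsilon>) \<le> lam * \<alpha> * c"
      using c(2) assms(7,9) by (intro mult_left_mono) auto
    then show "lam * \<alpha> * (OPT lam V m f - \<epsilon>) \<le> objective lam m f \<pi>hat"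
      using obj by linarith
  next
    fix \<delta> assume \<delta>: "0 < \<delta> \<and> \<delta> < \<alpha>"
    define \<beta> where "\<beta> = \<delta> / (1 - \<alpha> + \<delta>)"
    let ?I = "{i \<in> {1..m}. \<beta> * c \<le> F_mix lam m f i \<pi>hat}"
    have "real m * (\<alpha> - \<delta>) \<le> real (card ?I)"
      unfolding \<beta>_def
    proof (rule truncated_average_many_large)
      show "0 \<le> F_mix lam m f i \<pi>hat" if "i \<in> {1..m}" for i
        using assms(9,10) nonneg that by (intro F_mix_nonneg)
      show "\<alpha> * c \<le> 1 / real m * (\<Sum>i=1..m. min (F_mix lam m f i \<pi>hat) c)"
        using c(4) by (simp only: F_trunc_def)
    qed (use assms(2,8) \<delta> c(1) in auto)
    then have "\<lceil>real m * (\<alpha> - \<delta>)\<rceil> \<le> int (card ?I)" by (simp add: ceiling_le_iff)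
    moreover have "max \<beta> (lam * \<alpha>) * (OPT lam V m f - \<epsilon>) \<le> F_mix lam m f i \<pi>hat"
      if "i \<in> ?I" for i
    proof -
      \<comment> \<open>This half of the maximum holds at every index; only the \<beta> half depends
        on membership in \<open>?I\<close>.\<close>
      have "lam * \<alpha> * c \<le> F_mix lam m f i \<pi>hat"
        using obj objective_le_F_mix[OF assms(10), of i m f \<pi>hat] that by auto
      then have "max \<beta> (lam * \<alpha>) * c \<le> F_mix lam m f i \<pi>hat"
        using that by (simp add: max_def)
      moreover have "max \<beta> (lam * \<alpha>) * (OPT lam V m f - \<epsilon>) \<le> max \<beta> (lam * \<alpha>) * c"
        using c(2) assms(7,9) by (intro mult_left_mono) (auto simp: le_max_iff_disj)
      ultimately show ?thesis by linarith
    qed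
    ultimately show "\<exists>I \<subseteq> {1..m}. int (card I) \<ge> \<lceil>real m * (\<alpha> - \<delta>)\<rceil> \<and>
          (\<forall>i\<in>I. F_mix lam m f i \<pi>hat
             \<ge> max (\<delta> / (1 - \<alpha> + \<delta>)) (lam * \<alpha>) * (OPT lam V m f - \<epsilon>))"
      unfolding \<beta>_def[symmetric] by (intro exI[of _ ?I]) blast
  qed
qed

end
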